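(* Let $n > 2$ be an integer and let $b > 0$ be real. Then $$h_{n}(b) = \frac{n-2}{n-1}\, h_{n-1}(b) + \frac{b \, \ln b}{(n-1)(1+b)^{n-1}} + \frac{1 - (1+b)^{n-2}}{(n-1)(n-2)(1+b)^{n-2}}.$$
   Context: For an integer $n$ and real $b>0$, $h_{n}(b) := \int_{0}^{b} \frac{\ln t \, dt}{(1+t)^{n}}$. *)

theory Defs
  imports "HOL-Analysis.Analysis"
begin

text \<open>
  The integral is improper at \<open>0\<close> because of the logarithmic singularity. The gauge integral over
  \<open>{0..b}\<close> covers this; the value of the integrand at the single point \<open>0\<close> is irrelevant.
\<close>

definition h :: "int \<Rightarrow> real \<Rightarrow> real" where
  "h n b = integral {0..b} (\<lambda>t. ln t / (1 + t) powi n)"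

end

theory Submission
  imports Defs "HOL-Real_Asymp.Real_Asymp"
begin

text \<open>
  The recurrence is integration by parts, packaged as one primitive. For every integer \<open>m\<close>,
  differentiating \<open>t ln t / (1 + t)\<^sup>m\<close> and rewriting \<open>t\<close> as \<open>(1 + t) - 1\<close> gives
  \<open>m ln t / (1 + t)\<^bsup>m+1\<^esup> - (m - 1) ln t / (1 + t)\<^sup>m + 1 / (1 + t)\<^sup>m\<close>.
  Since \<open>t ln t\<close> tends to \<open>0\<close> as \<open>t\<close> tends to \<open>0\<close>, the primitive is continuous on the closed
  interval, so the fundamental theorem of calculus applies in spite of the logarithmic singularity
  and yields the integral of this combination (\<open>has_integral_ln_combination\<close>). With \<open>m = n - 1\<close>
  and the elementary integral of \<open>1 / (1 + t)\<^bsup>n-1\<^esup>\<close>, this is the recurrence, provided that the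
  combination may be integrated term by term.

  The integrability of the separate terms comes from the same identity. For \<open>m = 1\<close> the middle term
  vanishes, and \<open>1 / (1 + t)\<close> is continuous, so
  \<open>ln t / (1 + t)\<^sup>2\<close> is integrable; larger exponents follow by induction, because the
  identity expresses each integrand through the preceding one and integrable terms.
\<close>

lemma continuous_on_id_times_ln: "continuous_on {0..} (\<lambda>t::real. t * ln t)"
proof (unfold continuous_on_eq_continuous_within, intro ballI)
  fix x :: real
  assume "x \<in> {0..}"
  then consider "x = 0" | "x > 0" by fastforce
  then show "continuous (at x within {0..}) (\<lambda>t. t * ln t)"
  proof cases
    case 1
    have "((\<lambda>t::real. t * ln t) \<longlongrightarrow> 0) (at_right 0)"
      by real_asymp
    then show ?thesis
      using 1 by (simp add: continuous_within at_within_Ici_at_right)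
  next
    case 2
    then show ?thesis
      by (intro continuous_intros) auto
  qed
qed

text \<open>
  The terms stay under a single integral because the separate integrability of the logarithmic ones
  is itself deduced from this lemma.
\<close>
lemma has_integral_ln_combination:
  fixes m :: int and b :: real
  assumes "b > 0"
  shows "((\<lambda>t. of_int m * (ln t / (1 + t) powi (m + 1))
             - (of_int m - 1) * (ln t / (1 + t) powi m) + 1 / (1 + t) powi m)
           has_integral b * ln b / (1 + b) powi m) {0..b}"
proof -
  let ?F = "\<lambda>t::real. t * ln t / (1 + t) powi m"
  let ?f = "\<lambda>t::real. of_int m * (ln t / (1 + t) powi (m + 1))
             - (of_int m - 1) * (ln t / (1 + t) powi m) + 1 / (1 + t) powi m"
  have "(?f has_integral ?F b - ?F 0) {0..b}"
  proof (rule fundamental_theorem_of_calculus_interior)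
    show "continuous_on {0..b} ?F"
      by (intro continuous_intros continuous_on_subset[OF continuous_on_id_times_ln]) auto
  next
    fix t :: real
    assume "t \<in> {0<..<b}"
    then have t: "t > 0" by simp
    \<comment> \<open>Writing all powers through the lowest one reduces the derivative to rational algebra.\<close>
    define P where "P = (1 + t) powi (m - 1)"
    have P: "P \<noteq> 0" "(1 + t) powi m = P * (1 + t)"
      "(1 + t) powi (m + 1) = P * (1 + t) * (1 + t)"
      using t power_int_add[of "1 + t" "m - 1" 1] power_int_add[of "1 + t" "m - 1" 2]
      by (simp_all add: P_def power2_eq_square ac_simps)
    have "(?F has_real_derivative
        ((ln t + 1) * (1 + t) powi m - t * ln t * (of_int m * (1 + t) powi (m - 1)))
          / ((1 + t) powi m * (1 + t) powi m)) (at t)"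
      using t by (auto intro!: derivative_eq_intros simp: field_simps)
    also have "((ln t + 1) * (1 + t) powi m - t * ln t * (of_int m * (1 + t) powi (m - 1)))
          / ((1 + t) powi m * (1 + t) powi m) = ?f t"
      unfolding P_def[symmetric] P(2,3) using P(1) t
      by (simp add: divide_simps) (simp add: algebra_simps)
    finally show "(?F has_vector_derivative ?f t) (at t)"
      by (simp add: has_real_derivative_iff_has_vector_derivative)
  qed (use assms in auto)
  then show ?thesis by simp
qed

lemma integrable_inverse_power_int:
  fixes m :: int and b :: real
  shows "(\<lambda>t. 1 / (1 + t) powi m) integrable_on {0..b}"
  by (intro integrable_continuous_real continuous_intros) auto

lemma has_integral_inverse_power_int:
  fixes m :: int and b :: real
  assumes "m \<noteq> 1" and "b > 0"
  shows "((\<lambda>t. 1 / (1 + t) powi m) has_integral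
           (1 - 1 / (1 + b) powi (m - 1)) / (of_int m - 1)) {0..b}"
proof -
  let ?F = "\<lambda>t::real. - ((1 + t) powi (1 - m)) / (of_int m - 1)"
  have "((\<lambda>t. 1 / (1 + t) powi m) has_integral ?F b - ?F 0) {0..b}"
  proof (rule fundamental_theorem_of_calculus)
    fix t :: real
    assume "t \<in> {0..b}"
    then have "1 + t \<noteq> 0" by simp
    then have "(?F has_real_derivative
        - (of_int (1 - m) * (1 + t) powi (1 - m - 1)) / (of_int m - 1)) (at t within {0..b})"
      using assms(1) by (auto intro!: derivative_eq_intros)
    also have "- (of_int (1 - m) * (1 + t) powi (1 - m - 1)) / (of_int m - 1)
        = 1 / (1 + t) powi m"
      using assms(1) \<open>1 + t \<noteq> 0\<close>
      by (simp add: power_int_minus divide_simps)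
    finally show "(?F has_vector_derivative 1 / (1 + t) powi m) (at t within {0..b})"
      by (simp add: has_real_derivative_iff_has_vector_derivative)
  qed (use assms in auto)
  moreover have "(1 + b) powi (1 - m) = 1 / (1 + b) powi (m - 1)"
    using power_int_minus[of "1 + b" "m - 1"] by (simp add: field_simps)
  ultimately show ?thesis
    by (simp add: diff_divide_distrib)
qed

text \<open>
  The induction starts at exponent \<open>2\<close>: solving the identity for the higher exponent means dividing
  by \<open>m\<close>, and at \<open>m = 1\<close> the lower exponent drops out.
\<close>
lemma integrable_ln_over_power_int:
  fixes n :: int and b :: real
  assumes "n \<ge> 2" and "b > 0"
  shows "(\<lambda>t. ln t / (1 + t) powi n) integrable_on {0..b}"
proof -
  have extend: "(\<lambda>t. ln t / (1 + t) powi (m + 1)) integrable_on {0..b}"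
    if "m \<ge> 1" and lower: "(\<lambda>t. (of_int m - 1) * (ln t / (1 + t) powi m)) integrable_on {0..b}"
    for m :: int
  proof -
    let ?u = "\<lambda>t::real. of_int m * (ln t / (1 + t) powi (m + 1))"
    let ?v = "\<lambda>t::real. (of_int m - 1) * (ln t / (1 + t) powi m)"
    let ?w = "\<lambda>t::real. 1 / (1 + t) powi m"
    have "(\<lambda>t. ?u t - ?v t + ?w t) integrable_on {0..b}"
      using has_integral_ln_combination[OF assms(2)] by (rule has_integral_integrable)
    from integrable_add[OF integrable_diff[OF this integrable_inverse_power_int[of m b]] lower]
    have "?u integrable_on {0..b}" by simp
    from integrable_on_cmult_left[OF this, of "1 / of_int m"] show ?thesis
      using \<open>m \<ge> 1\<close> by simp
  qed
  show ?thesis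
    using assms(1)
  proof (induction n rule: int_ge_induct)
    case base
    show ?case using extend[of 1] by (simp add: integrable_0)
  next
    case (step i)
    then show ?case
      using extend[of i] integrable_on_cmult_left[OF step.IH, of "of_int i - 1"]
      by simp
  qed
qed

theorem theorem4p1:
  fixes n :: int and b :: real
  assumes "n > 2" and "b > 0"
  shows "h n b =
      (of_int n - 2) / (of_int n - 1) * h (n - 1) b
    + b * ln b / ((of_int n - 1) * (1 + b) powi (n - 1))
    + (1 - (1 + b) powi (n - 2)) /
        ((of_int n - 1) * (of_int n - 2) * (1 + b) powi (n - 2))"
proof -
  let ?f = "\<lambda>k t::real. ln t / (1 + t) powi k"
  have ints: "(?f n has_integral h n b) {0..b}" "(?f (n - 1) has_integral h (n - 1) b) {0..b}"
    unfolding h_def using assms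
    by (auto intro!: integrable_integral integrable_ln_over_power_int)
  have "((\<lambda>t. 1 / (1 + t) powi (n - 1)) has_integral
      (1 - 1 / (1 + b) powi (n - 2)) / (of_int n - 2)) {0..b}"
    using has_integral_inverse_power_int[of "n - 1" b] assms by (simp add: algebra_simps)
  from has_integral_add[OF has_integral_diff[OF
      has_integral_mult_right[OF ints(1), of "of_int n - 1"]
      has_integral_mult_right[OF ints(2), of "of_int n - 2"]] this]
  have "((\<lambda>t. (of_int n - 1) * ?f n t - (of_int n - 2) * ?f (n - 1) t
        + 1 / (1 + t) powi (n - 1)) has_integral
      (of_int n - 1) * h n b - (of_int n - 2) * h (n - 1) b
        + (1 - 1 / (1 + b) powi (n - 2)) / (of_int n - 2)) {0..b}" .
  moreover have "((\<lambda>t. (of_int n - 1) * ?f n t - (of_int n - 2) * ?f (n - 1) t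
        + 1 / (1 + t) powi (n - 1)) has_integral b * ln b / (1 + b) powi (n - 1)) {0..b}"
    using has_integral_ln_combination[OF assms(2), of "n - 1"] by simp
  ultimately have recurrence: "(of_int n - 1) * h n b - (of_int n - 2) * h (n - 1) b
        + (1 - 1 / (1 + b) powi (n - 2)) / (of_int n - 2) = b * ln b / (1 + b) powi (n - 1)"
    by (rule has_integral_unique)
  define N where "N = (of_int n :: real)"
  define P where "P = (1 + b) powi (n - 1)"
  define Q where "Q = (1 + b) powi (n - 2)"
  have pos: "N - 1 > 0" "N - 2 > 0" "P > 0" "Q > 0"
    using assms by (simp_all add: N_def P_def Q_def)
  have "(N - 1) * h n b = (N - 2) * h (n - 1) b + b * ln b / P - (1 - 1 / Q) / (N - 2)"
    using recurrence unfolding N_def P_def Q_def by simp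
  then have "h n b = ((N - 2) * h (n - 1) b + b * ln b / P - (1 - 1 / Q) / (N - 2)) / (N - 1)"
    using pos by (metis nonzero_mult_div_cancel_left less_irrefl)
  also have "\<dots> = (N - 2) / (N - 1) * h (n - 1) b + b * ln b / ((N - 1) * P)
      + (1 - Q) / ((N - 1) * (N - 2) * Q)"
  proof -
    have "(1 - 1 / Q) / (N - 2) = - ((1 - Q) / ((N - 2) * Q))"
      using pos by (simp add: divide_simps)
    then show ?thesis
      by (simp add: add_divide_distrib mult_ac)
  qed
  finally show ?thesis
    unfolding N_def P_def Q_def .
qed

end
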